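(* Let $\alpha>0$ be real. Then $$\sum_{i,j\geq 0}\frac{q^{\alpha i^2+2ij+\alpha i+j}}{(q;q)_{2i}(q;q)_{j}}=\frac{(-q^{2\alpha};q^{2\alpha})_\infty^2(q^{2\alpha};q^{2\alpha})_\infty}{(q;q)_{\infty}},\qquad \sum_{i,j\geq 0} \frac{q^{\alpha i^2+2ij+\alpha i+2j}}{(q;q)_{2i+1}(q;q)_{j}}=\frac{(-q^{2\alpha};q^{2\alpha})_\infty^2(q^{2\alpha};q^{2\alpha})_\infty}{(q;q)_{\infty}},$$ and moreover $$\sum_{i,j\geq 0}\frac{q^{\frac{1}{2}i^2+2ij-\frac{1}{2}i+2j}}{(q;q)_{2i}(q;q)_{j}}=\frac{2}{(q;q)_\infty},\quad \sum_{i,j\geq 0} \frac{q^{i^2+2ij+2j}}{(q;q)_{2i}(q;q)_{j}}=\frac{1}{(q;q)_\infty},\quad \sum_{i,j\geq 0} \frac{q^{i^2+2ij+i+3j}}{(q;q)_{2i+1}(q;q)_{j}}=\frac{1}{(q;q)_\infty},$$ $$\sum_{i,j\geq 0} \frac{q^{\frac{1}{2}i^2+2ij+\frac{1}{2}i+2j}}{(q;q)_{i}(q;q)_{2j}}=\frac{(-q^{6},-q^{10},q^{16};q^{16})_{\infty}}{(q;q)_{\infty}},\qquad \sum_{i,j\geq 0} \frac{q^{\frac{1}{2}i^2+2ij+\frac{3}{2}i+2j}}{(q;q)_{i}(q;q)_{2j+1}}=\frac{(-q^{2},-q^{14},q^{16};q^{16})_{\infty}}{(q;q)_{\infty}}.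$$
   Context: Write $q=e^{2\pi i\tau}$ with $\operatorname{Im}\tau>0$ and $q^x:=e^{2\pi i\tau x}$ for real $x$. For $|q|<1$: $(a;q)_\infty=\prod_{k\ge0}(1-aq^k)$; for integers $n\ge0$, $(a;q)_n=\prod_{k=0}^{n-1}(1-aq^k)$; $(a_1,\dots,a_m;q)_\infty=\prod_k(a_k;q)_\infty$; and $(a;q^{2\alpha})_\infty=\prod_{k\ge0}(1-aq^{2\alpha k})$. *)

theory Defs
  imports "HOL-Analysis.Analysis"
begin

definition qpow :: "complex \<Rightarrow> real \<Rightarrow> complex" where
  "qpow \<tau> x = exp (2 * of_real pi * \<i> * \<tau> * of_real x)"

definition qpoch :: "complex \<Rightarrow> complex \<Rightarrow> nat \<Rightarrow> complex" where
  "qpoch a q n = (\<Prod>k<n. 1 - a * q ^ k)"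

(* Used with norm q < 1 only, where the product converges; it is 0 if one of the factors is 0. *)
definition qpoch_inf :: "complex \<Rightarrow> complex \<Rightarrow> complex" where
  "qpoch_inf a q = (\<Prod>k. 1 - a * q ^ k)"

definition qpochs_inf :: "complex list \<Rightarrow> complex \<Rightarrow> complex" where
  "qpochs_inf as q = prod_list (map (\<lambda>a. qpoch_inf a q) as)"

end

theory Submission
  imports Defs "HOL-Library.Nat_Bijection"
begin

text \<open>Since \<open>(q;q)\<^sub>k (q\<^sup>k\<^sup>+\<^sup>1;q)\<^sub>\<infinity> = (q;q)\<^sub>\<infinity>\<close>, summing over \<open>j\<close> first by Euler's expansion of
  \<open>1 / (z;q)\<^sub>\<infinity>\<close> turns each of the first five double series into \<open>1 / (q;q)\<^sub>\<infinity>\<close> times a single series: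
  a theta series evaluated by the Jacobi triple product in the first two cases, a telescoping series
  in the other three. In the last two, summing over \<open>i\<close> first by Euler's expansion of
  \<open>(- z;q)\<^sub>\<infinity>\<close> leaves the even or odd part in \<open>z\<close>, at \<open>z = q\<close>, of \<open>1 / (z;q\<^sup>2)\<^sub>\<infinity>\<close>. By Gauss' identity
  this is, up to the factor \<open>1 / (q;q)\<^sub>\<infinity>\<close>, the even or odd part in \<open>q\<close> of the sum of \<open>q\<close> to the
  triangular numbers, whose terms (grouped by the index modulo 4) form a theta series of base
  \<open>q\<^sup>1\<^sup>6\<close>.\<close>

subsection \<open>Euler's expansions\<close>

lemma qpoch_0 [simp]: "qpoch a q 0 = 1"
  by (simp add: qpoch_def)

lemma qpoch_Suc: "qpoch a q (Suc n) = qpoch a q n * (1 - a * q ^ n)"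
  by (simp add: qpoch_def)

lemma qpoch_add: "qpoch a q (m + n) = qpoch a q m * qpoch (a * q ^ m) q n"
  by (induction n) (simp_all add: qpoch_Suc power_add mult_ac)

lemma convergent_qpoch:
  fixes a q :: complex
  assumes "norm q < 1"
  shows "convergent_prod (\<lambda>k. 1 - a * q ^ k)"
proof -
  have "summable (\<lambda>k. norm ((1 - a * q ^ k) - 1))"
    using assms by (simp add: norm_mult norm_power summable_mult summable_geometric)
  then show ?thesis
    by (intro abs_convergent_prod_imp_convergent_prod summable_imp_abs_convergent_prod)
qed

lemma qpoch_tendsto:
  assumes "norm q < 1"
  shows "qpoch a q \<longlonglongrightarrow> qpoch_inf a q"
  using convergent_prod_LIMSEQ[OF convergent_qpoch[OF assms]]
  unfolding qpoch_def[abs_def] qpoch_inf_def LIMSEQ_lessThan_iff_atMost .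

lemma qpoch_inf_split:
  assumes "norm q < 1"
  shows "qpoch_inf a q = qpoch a q m * qpoch_inf (a * q ^ m) q"
proof (rule LIMSEQ_unique)
  show "(\<lambda>n. qpoch a q (m + n)) \<longlonglongrightarrow> qpoch_inf a q"
    using LIMSEQ_ignore_initial_segment[OF qpoch_tendsto[OF assms], of a m] by (simp add: add.commute)
  show "(\<lambda>n. qpoch a q (m + n)) \<longlonglongrightarrow> qpoch a q m * qpoch_inf (a * q ^ m) q"
    unfolding qpoch_add by (intro tendsto_intros qpoch_tendsto assms)
qed

lemma one_minus_mult_power_nonzero:
  fixes a q :: complex
  assumes "norm q < 1" "norm a < 1"
  shows "1 - a * q ^ k \<noteq> 0"
proof
  assume "1 - a * q ^ k = 0"
  then have "norm (a * q ^ k) = 1" by simp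
  moreover have "norm a * norm q ^ k \<le> norm a * 1"
    using assms by (intro mult_left_mono power_le_one) auto
  ultimately show False using assms by (simp add: norm_mult norm_power)
qed

lemma qpoch_nonzero: "norm q < 1 \<Longrightarrow> norm a < 1 \<Longrightarrow> qpoch a q n \<noteq> 0"
  using one_minus_mult_power_nonzero by (simp add: qpoch_def)

lemma qpoch_inf_nonzero:
  assumes "norm q < 1" "norm a < 1"
  shows "qpoch_inf a q \<noteq> 0"
  unfolding qpoch_inf_def
  by (rule prodinf_nonzero[OF convergent_qpoch[OF assms(1)] one_minus_mult_power_nonzero[OF assms]])

text \<open>The reciprocals converge because the limit \<open>qpoch_inf q q\<close> is nonzero. The
  constant C is the uniform bound behind every domination argument below.\<close>

lemma inverse_qpoch_bounded:
  assumes "norm q < 1"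
  obtains C where "C > 0" "\<And>n. norm (1 / qpoch q q n) \<le> C"
proof -
  have "(\<lambda>n. 1 / qpoch q q n) \<longlonglongrightarrow> 1 / qpoch_inf q q"
    using assms by (intro tendsto_intros qpoch_tendsto qpoch_inf_nonzero)
  then have "Bseq (\<lambda>n. 1 / qpoch q q n)" by (intro convergent_imp_Bseq convergentI)
  with that show ?thesis unfolding Bseq_def by blast
qed

text \<open>Consecutive terms have ratio r^(n+1) x, which tends to 0; hence \<open>x\<close> may be
  arbitrarily large.\<close>

lemma summable_triangle:
  fixes r x :: real
  assumes "0 \<le> r" "r < 1" "0 \<le> x"
  shows "summable (\<lambda>n. r ^ triangle n * x ^ n)"
proof -
  have "(\<lambda>n. r ^ Suc n * x) \<longlonglongrightarrow> 0 * x"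
    using assms by (intro tendsto_intros LIMSEQ_Suc LIMSEQ_power_zero) auto
  then have "eventually (\<lambda>n. r ^ Suc n * x < 1/2) sequentially"
    by (rule order_tendstoD) simp
  then obtain N where N: "\<And>n. n \<ge> N \<Longrightarrow> r ^ Suc n * x < 1/2"
    unfolding eventually_sequentially by blast
  show ?thesis
  proof (rule summable_ratio_test[where N = N and c = "1/2"])
    fix n assume "n \<ge> N"
    have "r ^ triangle (Suc n) * x ^ Suc n = (r ^ Suc n * x) * (r ^ triangle n * x ^ n)"
      by (simp add: power_add)
    also have "\<dots> \<le> 1/2 * (r ^ triangle n * x ^ n)"
      using N[OF \<open>n \<ge> N\<close>] assms by (intro mult_right_mono) auto
    finally show "norm (r ^ triangle (Suc n) * x ^ Suc n) \<le> 1/2 * norm (r ^ triangle n * x ^ n)"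
      using assms by (simp del: triangle_Suc)
  qed simp
qed

lemma tendsto_iterate_at_0:
  fixes q z :: complex
  assumes "isCont F 0" "norm q < 1"
  shows "(\<lambda>n. F (z * q ^ n)) \<longlonglongrightarrow> F 0"
proof (rule isCont_tendsto_compose[OF assms(1)])
  have "(\<lambda>n. z * q ^ n) \<longlonglongrightarrow> z * 0"
    using assms by (intro tendsto_intros LIMSEQ_power_zero)
  then show "(\<lambda>n. z * q ^ n) \<longlonglongrightarrow> 0" by simp
qed

text \<open>The power series F satisfies F(x) (1 - x) = F(x q). Iterating gives F(z) (z;q)_n = F(z
  q^n), and the right side tends to F(0) = 1 by continuity at 0.\<close>

lemma Euler_inverse_product:
  fixes q z :: complex
  assumes q: "norm q < 1" and z: "norm z < 1"
  shows "(\<lambda>n. z ^ n / qpoch q q n) sums (1 / qpoch_inf z q)"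
proof -
  obtain C where C: "C > 0" "\<And>n. norm (1 / qpoch q q n) \<le> C"
    using inverse_qpoch_bounded[OF q] by blast
  define F where "F x = (\<Sum>n. 1 / qpoch q q n * x ^ n)" for x
  have summ: "summable (\<lambda>n. 1 / qpoch q q n * x ^ n)" if "norm x < 1" for x
  proof (rule summable_comparison_test')
    show "summable (\<lambda>n. C * norm x ^ n)"
      using that by (intro summable_mult summable_geometric) auto
    show "norm (1 / qpoch q q n * x ^ n) \<le> C * norm x ^ n" for n
      unfolding norm_mult norm_power by (intro mult_right_mono C) auto
  qed
  have step: "F x * (1 - x) = F (x * q)" if x: "norm x < 1" for x
  proof -
    have "norm (x * q) < 1"
      using mult_strict_mono'[of "norm x" 1 "norm q" 1] that q by (simp add: norm_mult)
    then have "(\<lambda>n. 1 / qpoch q q n * x ^ n - 1 / qpoch q q n * (x * q) ^ n) sums (F x - F (x * q))"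
      unfolding F_def by (intro sums_diff summable_sums summ x)
    \<comment> \<open>The two constant terms cancel, so the series can start at index 1. There the
      factor 1 - q^(n+1) from x^(n+1) - (x q)^(n+1) cancels the last factor of (q;q)_(n+1).\<close>
    then have "(\<lambda>n. 1 / qpoch q q (Suc n) * x ^ Suc n - 1 / qpoch q q (Suc n) * (x * q) ^ Suc n)
        sums (F x - F (x * q))"
      by (subst sums_Suc_iff) simp
    moreover have "1 / qpoch q q (Suc n) * x ^ Suc n - 1 / qpoch q q (Suc n) * (x * q) ^ Suc n
        = x * (1 / qpoch q q n * x ^ n)" for n
      using qpoch_nonzero[OF q q, of n] one_minus_mult_power_nonzero[OF q q, of n]
      by (simp add: qpoch_Suc power_mult_distrib divide_simps) (simp add: algebra_simps)
    ultimately have "(\<lambda>n. x * (1 / qpoch q q n * x ^ n)) sums (F x - F (x * q))"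
      by simp
    moreover have "(\<lambda>n. x * (1 / qpoch q q n * x ^ n)) sums (x * F x)"
      unfolding F_def by (intro sums_mult summable_sums summ x)
    ultimately have "F x - F (x * q) = x * F x" by (rule sums_unique2)
    then show ?thesis by (simp add: algebra_simps)
  qed
  have iter: "F z * qpoch z q n = F (z * q ^ n)" for n
  proof (induction n)
    case (Suc n)
    have "norm z * norm q ^ n \<le> norm z * 1"
      using q by (intro mult_left_mono power_le_one) auto
    then have "norm (z * q ^ n) < 1" using z by (simp add: norm_mult norm_power)
    then have "F (z * q ^ n) * (1 - z * q ^ n) = F (z * q ^ n * q)" by (rule step)
    moreover have "F z * qpoch z q (Suc n) = (F z * qpoch z q n) * (1 - z * q ^ n)"
      by (simp add: qpoch_Suc)
    ultimately show ?case unfolding Suc by (simp add: mult_ac)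
  qed simp
  have "isCont F 0"
    unfolding F_def by (rule isCont_powser[where K = "1/2"]) (use summ[of "1/2"] in auto)
  then have "(\<lambda>n. F z * qpoch z q n) \<longlonglongrightarrow> F 0"
    unfolding iter using q by (rule tendsto_iterate_at_0)
  moreover have "(\<lambda>n. F z * qpoch z q n) \<longlonglongrightarrow> F z * qpoch_inf z q"
    by (intro tendsto_intros qpoch_tendsto q)
  moreover have "F 0 = 1"
    unfolding F_def using powser_zero[of "\<lambda>n. 1 / qpoch q q n"] by simp
  ultimately have "F z * qpoch_inf z q = 1" using LIMSEQ_unique by metis
  then have "F z = 1 / qpoch_inf z q"
    using qpoch_inf_nonzero[OF q z] by (simp add: field_simps)
  with summable_sums[OF summ[OF z]] show ?thesis unfolding F_def by simp
qed

text \<open>Same method, with the functional equation F(x) = (1 + x q) F(x q). The triangular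
  exponents make F entire, so \<open>z\<close> is unrestricted; using n(n+1)/2 instead of n(n-1)/2
  moves the argument of the product from -z to -z q.\<close>

lemma Euler_product:
  fixes q z :: complex
  assumes q: "norm q < 1"
  shows "(\<lambda>n. q ^ triangle n * z ^ n / qpoch q q n) sums qpoch_inf (- z * q) q"
proof -
  obtain C where C: "C > 0" "\<And>n. norm (1 / qpoch q q n) \<le> C"
    using inverse_qpoch_bounded[OF q] by blast
  define c where "c n = q ^ triangle n / qpoch q q n" for n
  define F where "F x = (\<Sum>n. c n * x ^ n)" for x
  have summ: "summable (\<lambda>n. c n * x ^ n)" for x
  proof (rule summable_comparison_test')
    show "summable (\<lambda>n. C * (norm q ^ triangle n * norm x ^ n))"
      using q by (intro summable_mult summable_triangle) auto
    have "norm (1 / qpoch q q n) * (norm q ^ triangle n * norm x ^ n) 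
        \<le> C * (norm q ^ triangle n * norm x ^ n)" for n
      by (intro mult_right_mono C) auto
    then show "norm (c n * x ^ n) \<le> C * (norm q ^ triangle n * norm x ^ n)" for n
      by (simp add: c_def norm_mult norm_power norm_divide)
  qed
  have step: "F x = (1 + x * q) * F (x * q)" for x
  proof -
    have "(\<lambda>n. c n * x ^ n - c n * (x * q) ^ n) sums (F x - F (x * q))"
      unfolding F_def by (intro sums_diff summable_sums summ)
    then have "(\<lambda>n. c (Suc n) * x ^ Suc n - c (Suc n) * (x * q) ^ Suc n) sums (F x - F (x * q))"
      by (subst sums_Suc_iff) simp
    moreover have "c (Suc n) * x ^ Suc n - c (Suc n) * (x * q) ^ Suc n
        = x * q * (c n * (x * q) ^ n)" for n
      unfolding c_def
      using qpoch_nonzero[OF q q, of n] one_minus_mult_power_nonzero[OF q q, of n]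
      by (simp add: qpoch_Suc power_mult_distrib power_add divide_simps) (simp add: algebra_simps)
    ultimately have "(\<lambda>n. x * q * (c n * (x * q) ^ n)) sums (F x - F (x * q))"
      by simp
    moreover have "(\<lambda>n. x * q * (c n * (x * q) ^ n)) sums (x * q * F (x * q))"
      unfolding F_def by (intro sums_mult summable_sums summ)
    ultimately have "F x - F (x * q) = x * q * F (x * q)" by (rule sums_unique2)
    then show ?thesis by (simp add: algebra_simps)
  qed
  have iter: "F z = qpoch (- z * q) q n * F (z * q ^ n)" for n
  proof (induction n)
    case (Suc n)
    with step[of "z * q ^ n"] show ?case by (simp add: qpoch_Suc mult_ac)
  qed simp
  have "isCont F 0"
    unfolding F_def by (rule isCont_powser[where K = 1]) (use summ[of 1] in auto)
  then have "(\<lambda>n. qpoch (- z * q) q n * F (z * q ^ n)) \<longlonglongrightarrow> qpoch_inf (- z * q) q * F 0"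
    by (intro tendsto_intros qpoch_tendsto tendsto_iterate_at_0 q)
  then have "F z = qpoch_inf (- z * q) q * F 0"
    unfolding iter[symmetric] by (simp add: LIMSEQ_const_iff)
  moreover have "F 0 = 1"
    unfolding F_def using powser_zero[of c] by (simp add: c_def)
  ultimately show ?thesis
    using summable_sums[OF summ[of z]] unfolding F_def c_def by simp
qed

subsection \<open>The Jacobi triple product\<close>

text \<open>The paired summands at \<^term>\<open>m + 1\<close> and \<^term>\<open>- m\<close> of the bilateral finite triple product
  have the same coefficient, the Gaussian binomial of \<^term>\<open>2 * N + 1\<close> over \<^term>\<open>N - m\<close>.\<close>

definition jtp_coeff :: "complex \<Rightarrow> nat \<Rightarrow> nat \<Rightarrow> complex" where
  "jtp_coeff q N m =
     (if m \<le> N then qpoch q q (2 * N + 1) / (qpoch q q (N - m) * qpoch q q (N + 1 + m)) else 0)"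

text \<open>Puts all terms of the recurrence below over one denominator: each becomes
  \<open>RS\<close> times a polynomial in \<open>u\<close>, \<open>b\<close> and \<open>q\<close>,
  so that only a polynomial identity remains. At m = 0 the predecessor, of index -1, is read as the
  coefficient at 0, by the symmetry of the Gaussian binomial under m -> -1 - m.\<close>

lemma jtp_coeff_factors:
  fixes q :: complex
  assumes q: "norm q < 1" and m: "m \<le> N + 1"
  defines "u \<equiv> q ^ (N + 1 - m)" and "b \<equiv> q ^ (N + m + 1)"
    and "RS \<equiv> qpoch q q (2 * N + 1) / (qpoch q q (N + 1 - m) * qpoch q q (N + 2 + m))"
  shows "jtp_coeff q (Suc N) m = RS * (1 - b * u) * (1 - b * u * q)"
    and "jtp_coeff q N m = RS * (1 - u) * (1 - b * q)"
    and "q * jtp_coeff q N (Suc m) = RS * (1 - u) * (q - u)"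
    and "(if m = 0 then jtp_coeff q N 0 else jtp_coeff q N (m - 1)) = RS * (1 - b) * (1 - b * q)"
proof -
  note nz = qpoch_nonzero[OF q q]
  have nz1: "1 - q ^ Suc k \<noteq> 0" for k
    using one_minus_mult_power_nonzero[OF q q, of k] by simp
  have bu: "b * u = q ^ (2 * N + 2)"
    using m by (simp add: b_def u_def mult_2 power_add[symmetric])
  have upper: "qpoch q q (N + 2 + m) = qpoch q q (N + 1 + m) * (1 - b * q)"
    by (simp add: qpoch_Suc b_def mult_ac)
  have upper': "qpoch q q (N + 1 + m) = qpoch q q (N + m) * (1 - b)"
    by (simp add: qpoch_Suc b_def mult_ac)
  have b1: "1 - b * q \<noteq> 0" "1 - b \<noteq> 0"
    using nz1[of "N + m + 1"] nz1[of "N + m"] by (simp_all add: b_def mult_ac)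
  have "qpoch q q (2 * Suc N + 1) = qpoch q q (2 * N + 1) * (1 - b * u) * (1 - b * u * q)"
    unfolding bu by (simp add: qpoch_Suc mult_ac)
  then show "jtp_coeff q (Suc N) m = RS * (1 - b * u) * (1 - b * u * q)"
    using m by (simp add: jtp_coeff_def RS_def)
  show "jtp_coeff q N m = RS * (1 - u) * (1 - b * q)"
  proof (cases "m \<le> N")
    case True
    then have "qpoch q q (N + 1 - m) = qpoch q q (N - m) * (1 - u)" "1 - u \<noteq> 0"
      using nz1[of "N - m"] by (simp_all add: qpoch_Suc u_def Suc_diff_le)
    then show ?thesis
      using True b1 nz unfolding jtp_coeff_def RS_def upper by (simp add: divide_simps)
  next
    case False
    with m have "u = 1" by (simp add: u_def)
    with False show ?thesis by (simp add: jtp_coeff_def)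
  qed
  show "q * jtp_coeff q N (Suc m) = RS * (1 - u) * (q - u)"
  proof -
    \<comment> \<open>At the two boundary values \<open>jtp_coeff q N (Suc m)\<close> is 0 by
      default, and the right side vanishes too: u = q for m = N, and u = 1 for m = N + 1.\<close>
    consider "m < N" | "m = N" | "m = N + 1" using m by linarith
    then show ?thesis
    proof cases
      case 1
      define k where "k = N - Suc m"
      have k: "N + 1 - m = Suc (Suc k)" "N - Suc m = k" using 1 by (auto simp: k_def)
      have u: "u = q ^ Suc (Suc k)" unfolding u_def k ..
      have qu: "q - u = q * (1 - q ^ Suc k)" unfolding u by (simp add: algebra_simps)
      have lower: "qpoch q q (N + 1 - m) = qpoch q q k * (1 - q ^ Suc k) * (1 - u)"
        unfolding k u by (simp add: qpoch_Suc)
      have "1 - u \<noteq> 0" unfolding u by (rule nz1)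
      then have cancel: "q * (K / (a * s)) = K / (a * (1 - q ^ Suc k) * (1 - u) * s) * (1 - u) * (q * (1 - q ^ Suc k))"
        for K a s using nz1[of k] by simp
      have "jtp_coeff q N (Suc m) = qpoch q q (2 * N + 1) / (qpoch q q k * qpoch q q (N + 2 + m))"
        using 1 unfolding jtp_coeff_def k by simp
      then show ?thesis
        unfolding RS_def lower qu by (simp only: cancel)
    next
      case 2
      then show ?thesis by (simp add: jtp_coeff_def u_def)
    next
      case 3
      then show ?thesis by (simp add: jtp_coeff_def u_def)
    qed
  qed
  show "(if m = 0 then jtp_coeff q N 0 else jtp_coeff q N (m - 1)) = RS * (1 - b) * (1 - b * q)"
  proof (cases m)
    case 0
    then show ?thesis
      using b1 nz upper upper' unfolding jtp_coeff_def RS_def by (simp add: divide_simps)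
  next
    case (Suc k)
    then have "N + 1 - m = N - k" "N + 1 + k = N + m" "k \<le> N" using m by auto
    then show ?thesis
      using Suc b1 nz upper upper' unfolding jtp_coeff_def RS_def by (simp add: divide_simps)
  qed
qed

text \<open>This compares coefficients after multiplication by (1 + z q^(N+1)) (1 + q^(N+1) / z) = 1
  + q^(2N+2) + q^(N+1) (z + 1/z). Pulling out q to the m-th triangular number turns the factor
  q^(N+1) of the two neighbours into q^(N+1-m) and q^(N+m+2).\<close>

lemma jtp_coeff_rec:
  fixes q :: complex
  assumes q: "norm q < 1" and m: "m \<le> N + 1"
  shows "jtp_coeff q (Suc N) m = (1 + q ^ (2 * N + 2)) * jtp_coeff q N m
    + q ^ (N + 1 - m) * (if m = 0 then jtp_coeff q N 0 else jtp_coeff q N (m - 1))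
    + q ^ (N + m + 2) * jtp_coeff q N (Suc m)"
proof -
  define u b where "u = q ^ (N + 1 - m)" and "b = q ^ (N + m + 1)"
  have bu: "q ^ (2 * N + 2) = b * u"
    using m by (simp add: b_def u_def mult_2 power_add[symmetric])
  obtain R where R: "jtp_coeff q (Suc N) m = R * (1 - b * u) * (1 - b * u * q)"
    "jtp_coeff q N m = R * (1 - u) * (1 - b * q)"
    "q * jtp_coeff q N (Suc m) = R * (1 - u) * (q - u)"
    "(if m = 0 then jtp_coeff q N 0 else jtp_coeff q N (m - 1)) = R * (1 - b) * (1 - b * q)"
    unfolding u_def b_def using jtp_coeff_factors[OF q m] by blast
  have "q ^ (N + m + 2) * jtp_coeff q N (Suc m) = b * (q * jtp_coeff q N (Suc m))"
    by (simp add: b_def)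
  then show ?thesis
    unfolding bu u_def[symmetric] R by (simp add: algebra_simps)
qed

lemma sum_atMost_shift_eq:
  fixes f :: "nat \<Rightarrow> 'a::comm_monoid_add"
  assumes "f (Suc N) = 0"
  shows "(\<Sum>m\<le>N. f m) = f 0 + (\<Sum>m\<le>N. f (Suc m))"
  using sum.atMost_Suc_shift[of f N] sum.atMost_Suc[of f N] assms by simp

text \<open>Induction on \<open>N\<close>: the two new factors multiply the product by A + B (z +
  1/z), and \<open>jtp_coeff_rec\<close> says that the coefficients change in the same way.\<close>

lemma finite_triple_product:
  fixes q z :: complex
  assumes q: "norm q < 1" and z: "z \<noteq> 0"
  shows "qpoch (- z) q (N + 1) * qpoch (- (q / z)) q N =
    (\<Sum>m\<le>N. jtp_coeff q N m * (q ^ triangle m * (z ^ (m + 1) + (1 / z) ^ m)))"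
proof (induction N)
  case 0
  show ?case using one_minus_mult_power_nonzero[OF q q, of 0] 
    by (simp add: jtp_coeff_def qpoch_Suc)
next
  case (Suc N)
  define w where "w m = z ^ (m + 1) + (1 / z) ^ m" for m
  define d where "d m = jtp_coeff q N m * q ^ triangle m" for m
  define d' where "d' m = jtp_coeff q (Suc N) m * q ^ triangle m" for m
  define A where "A = 1 + q ^ (2 * N + 2)"
  define B where "B = q ^ (N + 1)"
  have d0: "d m = 0" if "m > N" for m using that by (simp add: d_def jtp_coeff_def)
  have d'_0: "d' 0 = A * d 0 + B * (d 0 + d 1)"
    using jtp_coeff_rec[OF q, of 0 N]
    by (simp add: d_def d'_def A_def B_def algebra_simps)
  have d'_Suc: "d' (Suc m) = A * d (Suc m) + B * (d m + d (Suc (Suc m)))" if "m \<le> N" for m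
  proof -
    have "B * q ^ triangle m = q ^ (N - m) * q ^ triangle (Suc m)"
      using that by (simp add: B_def power_add[symmetric])
    moreover have "B * q ^ triangle (Suc (Suc m)) = q ^ (N + Suc m + 2) * q ^ triangle (Suc m)"
      by (simp add: B_def power_add mult_ac)
    moreover have "jtp_coeff q (Suc N) (Suc m) = A * jtp_coeff q N (Suc m)
        + q ^ (N - m) * jtp_coeff q N m + q ^ (N + Suc m + 2) * jtp_coeff q N (Suc (Suc m))"
      using jtp_coeff_rec[OF q, of "Suc m" N] that by (simp add: A_def)
    moreover have "B * (d m + d (Suc (Suc m))) = jtp_coeff q N m * (B * q ^ triangle m)
        + jtp_coeff q N (Suc (Suc m)) * (B * q ^ triangle (Suc (Suc m)))"
      by (simp add: d_def algebra_simps)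
    ultimately show ?thesis
      unfolding d_def[of "Suc m"] d'_def by (simp only:) (simp add: algebra_simps)
  qed
  \<comment> \<open>Multiplication by z + 1/z moves w m to its two neighbours. At the edge the
    missing w(-1) would be z^0 + z^1 = w 0, so the sum reflects into itself.\<close>
  have w0: "(z + 1 / z) * w 0 = w 1 + w 0"
    using z by (simp add: w_def field_simps power2_eq_square)
  have wS: "(z + 1 / z) * w (Suc m) = w (Suc (Suc m)) + w m" for m
    using z by (simp add: w_def field_simps)
  have P: "qpoch (- z) q (Suc N + 1) * qpoch (- (q / z)) q (Suc N)
      = (qpoch (- z) q (N + 1) * qpoch (- (q / z)) q N) * (A + B * (z + 1 / z))"
  proof -
    have "(1 + z * q ^ (N + 1)) * (1 + q / z * q ^ N) = A + B * (z + 1 / z)"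
      using z by (simp add: A_def B_def field_simps power_add power_mult power2_eq_square)
    then show ?thesis by (simp add: qpoch_Suc mult_ac)
  qed
  \<comment> \<open>Index shifts that lose nothing at the top, since d vanishes beyond N.\<close>
  have S: "(\<Sum>m\<le>N. d m * w m) = d 0 * w 0 + (\<Sum>m\<le>N. d (Suc m) * w (Suc m))"
    "(\<Sum>m\<le>N. d m * w (Suc m)) = d 0 * w 1 + (\<Sum>m\<le>N. d (Suc m) * w (Suc (Suc m)))"
    "(\<Sum>m\<le>N. d (Suc m) * w m) = d 1 * w 0 + (\<Sum>m\<le>N. d (Suc (Suc m)) * w (Suc m))"
    "(\<Sum>m\<le>N. d m * ((z + 1 / z) * w m))
       = d 0 * (w 1 + w 0) + (\<Sum>m\<le>N. d (Suc m) * (w (Suc (Suc m)) + w m))"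
    unfolding w0[symmetric] wS[symmetric]
    by (subst sum_atMost_shift_eq; simp add: d0)+
  have "(\<Sum>m\<le>Suc N. d' m * w m)
      = d' 0 * w 0 + (\<Sum>m\<le>N. (A * d (Suc m) + B * (d m + d (Suc (Suc m)))) * w (Suc m))"
    unfolding sum.atMost_Suc_shift by (simp add: d'_Suc)
  also have "\<dots> = A * (\<Sum>m\<le>N. d m * w m) + B * (d 0 * w 0 + d 1 * w 0
      + (\<Sum>m\<le>N. d m * w (Suc m)) + (\<Sum>m\<le>N. d (Suc (Suc m)) * w (Suc m)))"
    unfolding d'_0 S(1) by (simp add: algebra_simps sum.distrib sum_distrib_left)
  also have "\<dots> = A * (\<Sum>m\<le>N. d m * w m) + B * (\<Sum>m\<le>N. d m * ((z + 1 / z) * w m))"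
    unfolding S(2,4) using S(3) by (simp add: algebra_simps sum.distrib)
  also have "\<dots> = (\<Sum>m\<le>N. d m * w m) * (A + B * (z + 1 / z))"
    by (simp add: algebra_simps sum.distrib sum_distrib_left)
  finally show ?case unfolding P Suc by (simp add: d_def d'_def w_def mult_ac)
qed

text \<open>Limit of \<open>finite_triple_product\<close> as N grows, by Tannery's theorem: the
  coefficients are uniformly bounded and each tends to 1 / (q;q)_inf. The summand pairs the indices
  n = m + 1 and n = -m of the bilateral series of q^(n(n-1)/2) z^n.\<close>

lemma Jacobi_triple_product:
  fixes q z :: complex
  assumes q: "norm q < 1" and z: "z \<noteq> 0"
  shows "(\<lambda>m. q ^ triangle m * (z ^ (m + 1) + (1 / z) ^ m))
    sums (qpoch_inf q q * qpoch_inf (- z) q * qpoch_inf (- (q / z)) q)"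
proof -
  define w where "w m = q ^ triangle m * (z ^ (m + 1) + (1 / z) ^ m)" for m
  obtain C where C: "C > 0" "\<And>n. norm (1 / qpoch q q n) \<le> C"
    using inverse_qpoch_bounded[OF q] by blast
  have "Bseq (qpoch q q)" 
    using qpoch_tendsto[OF q, of q] by (intro convergent_imp_Bseq convergentI)
  then obtain D where D: "D > 0" "\<And>n. norm (qpoch q q n) \<le> D" unfolding Bseq_def by blast
  have bound: "norm (jtp_coeff q N m) \<le> D * (C * C)" for N m
  proof (cases "m \<le> N")
    case True
    then have "norm (jtp_coeff q N m) = norm (qpoch q q (2 * N + 1)) *
        (norm (1 / qpoch q q (N - m)) * norm (1 / qpoch q q (N + 1 + m)))"
      by (simp add: jtp_coeff_def norm_mult norm_divide)
    also have "\<dots> \<le> D * (C * C)"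
      using C D by (intro mult_mono) auto
    finally show ?thesis .
  qed (use C D in \<open>simp add: jtp_coeff_def\<close>)
  have lim: "(\<lambda>N. jtp_coeff q N m) \<longlonglongrightarrow> 1 / qpoch_inf q q" for m
  proof -
    have "filterlim (\<lambda>N::nat. 2 * N + 1) sequentially sequentially"
      "filterlim (\<lambda>N::nat. N - m) sequentially sequentially"
      "filterlim (\<lambda>N::nat. N + 1 + m) sequentially sequentially"
      by (rule filterlim_subseq filterlim_minus_const_nat_at_top; simp add: strict_mono_def)+
    then have *: "(\<lambda>N. qpoch q q (2 * N + 1) / (qpoch q q (N - m) * qpoch q q (N + 1 + m)))
      \<longlonglongrightarrow> qpoch_inf q q / (qpoch_inf q q * qpoch_inf q q)"
      using qpoch_inf_nonzero[OF q q]
      by (intro tendsto_divide tendsto_mult filterlim_compose[OF qpoch_tendsto[OF q]]) auto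
    have "eventually (\<lambda>N. qpoch q q (2 * N + 1) / (qpoch q q (N - m) * qpoch q q (N + 1 + m))
        = jtp_coeff q N m) sequentially"
      using eventually_ge_at_top[of m] by eventually_elim (simp add: jtp_coeff_def)
    from Lim_transform_eventually[OF * this] show ?thesis
      using qpoch_inf_nonzero[OF q q] by simp
  qed
  \<comment> \<open>Coefficients beyond N are 0, so the finite sum is an infinite series with a
    range independent of N, as Tannery's theorem requires.\<close>
  have fin: "(\<Sum>m. jtp_coeff q N m * w m) = qpoch (- z) q (N + 1) * qpoch (- (q / z)) q N" for N
    unfolding finite_triple_product[OF q z] w_def
    by (rule suminf_finite) (auto simp: jtp_coeff_def)
  have summ: "summable (\<lambda>m. norm (w m))"
  proof (rule summable_comparison_test')
    show "summable (\<lambda>m. norm z * (norm q ^ triangle m * norm z ^ m) 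
        + norm q ^ triangle m * norm (1 / z) ^ m)"
      using q by (intro summable_add summable_mult summable_triangle) auto
    have "norm (w m) \<le> norm q ^ triangle m * (norm z ^ (m + 1) + norm (1 / z) ^ m)" for m
      unfolding w_def norm_mult norm_power[symmetric]
      by (intro mult_left_mono norm_triangle_ineq) auto
    then show "norm (norm (w m)) \<le> norm z * (norm q ^ triangle m * norm z ^ m) 
        + norm q ^ triangle m * norm (1 / z) ^ m" for m
      by (simp add: algebra_simps)
  qed
  have T: "summable (\<lambda>m. norm (1 / qpoch_inf q q * w m)) \<and>
    (\<lambda>N. \<Sum>m. jtp_coeff q N m * w m) \<longlonglongrightarrow> (\<Sum>m. 1 / qpoch_inf q q * w m)"
  proof -
    have "norm (jtp_coeff q N m * w m) \<le> D * (C * C) * norm (w m)" for N m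
      unfolding norm_mult by (intro mult_right_mono bound) auto
    then have "eventually (\<lambda>(m, N). norm (jtp_coeff q N m * w m) \<le> D * (C * C) * norm (w m))
        (at_top \<times>\<^sub>F sequentially)"
      by (intro always_eventually) auto
    note ev = this
    have "(\<lambda>N. jtp_coeff q N m * w m) \<longlonglongrightarrow> 1 / qpoch_inf q q * w m" for m
      by (intro tendsto_mult lim tendsto_const)
    from tannerys_theorem[OF this ev summable_mult[OF summ] sequentially_bot] show ?thesis
      by blast
  qed
  have "(\<lambda>N. qpoch (- z) q (N + 1) * qpoch (- (q / z)) q N)
      \<longlonglongrightarrow> qpoch_inf (- z) q * qpoch_inf (- (q / z)) q"
    by (intro tendsto_mult qpoch_tendsto q LIMSEQ_ignore_initial_segment)
  with T have eq: "(\<Sum>m. 1 / qpoch_inf q q * w m) = qpoch_inf (- z) q * qpoch_inf (- (q / z)) q"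
    unfolding fin using LIMSEQ_unique by blast
  have "summable (\<lambda>m. 1 / qpoch_inf q q * w m)"
    by (rule summable_norm_cancel[OF conjunct1[OF T]])
  then have "(\<lambda>m. qpoch_inf q q * (1 / qpoch_inf q q * w m)) 
      sums (qpoch_inf q q * (qpoch_inf (- z) q * qpoch_inf (- (q / z)) q))"
    unfolding eq[symmetric] by (intro sums_mult summable_sums)
  then show ?thesis
    using qpoch_inf_nonzero[OF q q] by (simp add: w_def mult_ac)
qed

subsection \<open>Gauss' triangular number series\<close>

lemma qpoch_square: "qpoch (a\<^sup>2) (q\<^sup>2) n = qpoch a q n * qpoch (- a) q n"
  by (induction n) (simp_all add: qpoch_Suc algebra_simps power2_eq_square power_mult_distrib)

lemma qpoch_inf_square:
  assumes "norm q < 1"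
  shows "qpoch_inf (a\<^sup>2) (q\<^sup>2) = qpoch_inf a q * qpoch_inf (- a) q"
proof (rule LIMSEQ_unique)
  show "qpoch (a\<^sup>2) (q\<^sup>2) \<longlonglongrightarrow> qpoch_inf (a\<^sup>2) (q\<^sup>2)"
    using assms by (intro qpoch_tendsto) (simp add: norm_power power_less_one_iff)
  show "qpoch (a\<^sup>2) (q\<^sup>2) \<longlonglongrightarrow> qpoch_inf a q * qpoch_inf (- a) q"
    unfolding qpoch_square by (intro tendsto_mult qpoch_tendsto assms)
qed

lemma qpoch_bisect: "qpoch a q (2 * n) = qpoch a (q\<^sup>2) n * qpoch (a * q) (q\<^sup>2) n"
  by (induction n) (simp_all add: qpoch_Suc mult_ac flip: power_mult)

lemma qpoch_inf_bisect:
  assumes "norm q < 1"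
  shows "qpoch_inf a q = qpoch_inf a (q\<^sup>2) * qpoch_inf (a * q) (q\<^sup>2)"
proof (rule LIMSEQ_unique)
  have q2: "norm (q\<^sup>2) < 1" using assms by (simp add: norm_power power_less_one_iff)
  show "(\<lambda>n. qpoch a q (2 * n)) \<longlonglongrightarrow> qpoch_inf a q"
    by (rule filterlim_compose[OF qpoch_tendsto[OF assms]])
       (simp add: filterlim_subseq strict_mono_def)
  show "(\<lambda>n. qpoch a q (2 * n)) \<longlonglongrightarrow> qpoch_inf a (q\<^sup>2) * qpoch_inf (a * q) (q\<^sup>2)"
    unfolding qpoch_bisect by (intro tendsto_mult qpoch_tendsto q2)
qed

text \<open>The triple product at z = 1 counts every triangular power twice, and (-1;q)_inf = 2
  (-q;q)_inf supplies the same factor 2.\<close>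

lemma Gauss_triangle_sums:
  fixes q :: complex
  assumes q: "norm q < 1"
  shows "(\<lambda>n. q ^ triangle n) sums (qpoch_inf (- q) q ^ 2 * qpoch_inf q q)"
proof -
  have "qpoch_inf (- 1) q = 2 * qpoch_inf (- q) q"
    using qpoch_inf_split[OF q, of "- 1" 1] by (simp add: qpoch_Suc)
  with Jacobi_triple_product[OF q, of 1]
  have "(\<lambda>n. 2 * q ^ triangle n) sums (2 * (qpoch_inf (- q) q ^ 2 * qpoch_inf q q))"
    by (simp add: power2_eq_square mult_ac)
  from sums_divide[OF this, of 2] show ?thesis by simp
qed

text \<open>Follows from the previous form by Euler's identity (q;q^2)_inf (-q;q)_inf = 1. In this
  form 1 / (q;q^2)_inf appears, which Euler's expansion in base q^2 produces.\<close>

lemma Gauss_triangle_sums':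
  fixes q :: complex
  assumes q: "norm q < 1"
  shows "(\<lambda>n. q ^ triangle n) sums (qpoch_inf (q\<^sup>2) (q\<^sup>2) / qpoch_inf q (q\<^sup>2))"
proof -
  have q2: "norm (q\<^sup>2) < 1" using q by (simp add: norm_power power_less_one_iff)
  have nz: "qpoch_inf (q\<^sup>2) (q\<^sup>2) \<noteq> 0" "qpoch_inf q (q\<^sup>2) \<noteq> 0" "qpoch_inf q q \<noteq> 0"
    by (intro qpoch_inf_nonzero q q2)+
  have 1: "qpoch_inf (q\<^sup>2) (q\<^sup>2) = qpoch_inf q q * qpoch_inf (- q) q"
    by (rule qpoch_inf_square[OF q])
  have 2: "qpoch_inf q q = qpoch_inf q (q\<^sup>2) * qpoch_inf (q\<^sup>2) (q\<^sup>2)"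
    using qpoch_inf_bisect[OF q, of q] by (simp add: power2_eq_square)
  have "qpoch_inf (q\<^sup>2) (q\<^sup>2) * (qpoch_inf q (q\<^sup>2) * qpoch_inf (- q) q) = qpoch_inf (q\<^sup>2) (q\<^sup>2) * 1"
    using 1 2 by (simp add: mult_ac)
  then have "qpoch_inf q (q\<^sup>2) * qpoch_inf (- q) q = 1"
    using nz(1) mult_left_cancel by blast
  then have "qpoch_inf (- q) q = 1 / qpoch_inf q (q\<^sup>2)" using nz by (simp add: field_simps)
  moreover have "qpoch_inf (- q) q ^ 2 * qpoch_inf q q = qpoch_inf (q\<^sup>2) (q\<^sup>2) * qpoch_inf (- q) q"
    unfolding 1 by (simp add: power2_eq_square)
  ultimately have "qpoch_inf (- q) q ^ 2 * qpoch_inf q q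
      = qpoch_inf (q\<^sup>2) (q\<^sup>2) / qpoch_inf q (q\<^sup>2)"
    by simp
  with Gauss_triangle_sums[OF q] show ?thesis by simp
qed

section \<open>Even and odd parts of Euler's and Gauss' series\<close>

lemma
  fixes f :: "nat \<Rightarrow> complex"
  assumes f: "f sums s" and g: "(\<lambda>n. (-1) ^ n * f n) sums t"
  shows sums_even_part: "(\<lambda>n. f (2 * n)) sums ((s + t) / 2)"
    and sums_odd_part: "(\<lambda>n. f (2 * n + 1)) sums ((s - t) / 2)"
proof -
  have ivl: "{n * 2..<n * 2 + 2} = {2 * n, 2 * n + 1}" for n :: nat by auto
  show "(\<lambda>n. f (2 * n)) sums ((s + t) / 2)"
    using sums_divide[OF sums_group[OF sums_add[OF f g], of 2], of 2] unfolding ivl by simp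
  show "(\<lambda>n. f (2 * n + 1)) sums ((s - t) / 2)"
    using sums_divide[OF sums_group[OF sums_diff[OF f g], of 2], of 2] unfolding ivl by simp
qed

text \<open>Euler's expansion in base q^2 at z = q and z = -q; half the sum and half the difference
  select the even and odd indices.\<close>

lemma
  fixes q :: complex
  assumes q: "norm q < 1"
  defines "E \<equiv> \<lambda>x. 1 / qpoch_inf x (q\<^sup>2)"
  shows Euler_even_part: "(\<lambda>n. q ^ (2 * n) / qpoch (q\<^sup>2) (q\<^sup>2) (2 * n)) sums ((E q + E (- q)) / 2)"
    and Euler_odd_part: "(\<lambda>n. q ^ (2 * n + 1) / qpoch (q\<^sup>2) (q\<^sup>2) (2 * n + 1)) sums ((E q - E (- q)) / 2)"
proof -
  have q2: "norm (q\<^sup>2) < 1" using q by (simp add: norm_power power_less_one_iff)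
  have f: "(\<lambda>n. q ^ n / qpoch (q\<^sup>2) (q\<^sup>2) n) sums E q"
    unfolding E_def by (rule Euler_inverse_product[OF q2 q])
  have "(\<lambda>n. (- q) ^ n / qpoch (q\<^sup>2) (q\<^sup>2) n) sums E (- q)"
    unfolding E_def using q by (intro Euler_inverse_product q2) simp
  moreover have "(- q) ^ n / qpoch (q\<^sup>2) (q\<^sup>2) n = (-1) ^ n * (q ^ n / qpoch (q\<^sup>2) (q\<^sup>2) n)" for n
    using power_minus[of q n] by simp
  ultimately have g: "(\<lambda>n. (-1) ^ n * (q ^ n / qpoch (q\<^sup>2) (q\<^sup>2) n)) sums E (- q)"
    by simp
  show "(\<lambda>n. q ^ (2 * n) / qpoch (q\<^sup>2) (q\<^sup>2) (2 * n)) sums ((E q + E (- q)) / 2)"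
    by (rule sums_even_part[OF f g])
  show "(\<lambda>n. q ^ (2 * n + 1) / qpoch (q\<^sup>2) (q\<^sup>2) (2 * n + 1)) sums ((E q - E (- q)) / 2)"
    by (rule sums_odd_part[OF f g])
qed

text \<open>Splits the triangular numbers by index modulo 4 into 16 times a triangular number plus a
  linear term, to fit a theta series of base q^16. The first two add the linear term to the other
  side to avoid subtraction.\<close>

lemma
  shows triangle_4: "16 * triangle n = triangle (4 * n) + 6 * n"
    and triangle_4_1: "16 * triangle n + 1 = triangle (4 * n + 1) + 2 * n"
    and triangle_4_2: "triangle (4 * n + 2) = 16 * triangle n + 2 * n + 3"
    and triangle_4_3: "triangle (4 * n + 3) = 16 * triangle n + 6 * n + 6"
proof -
  have block: "triangle (m + 1) = triangle m + m + 1" "triangle (m + 2) = triangle m + 2 * m + 3"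
    "triangle (m + 3) = triangle m + 3 * m + 6" "triangle (m + 4) = triangle m + 4 * m + 10" for m
    by (simp_all add: eval_nat_numeral)
  show *: "16 * triangle n = triangle (4 * n) + 6 * n"
  proof (induction n)
    case (Suc n)
    have e: "triangle (4 * Suc n) = triangle (4 * n + 4)" by (simp add: algebra_simps)
    show ?case unfolding e block triangle_Suc using Suc by simp
  qed simp
  show "16 * triangle n + 1 = triangle (4 * n + 1) + 2 * n"
    "triangle (4 * n + 2) = 16 * triangle n + 2 * n + 3"
    "triangle (4 * n + 3) = 16 * triangle n + 6 * n + 6"
    unfolding * block by simp_all
qed

text \<open>The n-th triangular number is even exactly when n is 0 or 3 modulo 4. These residues
  give the triple product of base q^16 at z = q^6; the residues 1 and 2 give q times the one at z =
  q^2.\<close>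

lemma
  fixes q :: complex
  assumes q: "norm q < 1" "q \<noteq> 0"
  defines "psi \<equiv> \<lambda>x. qpoch_inf (x\<^sup>2) (x\<^sup>2) / qpoch_inf x (x\<^sup>2)"
  shows Gauss_even_part:
      "(psi q + psi (- q)) / 2 = qpochs_inf [- (q ^ 6), - (q ^ 10), q ^ 16] (q ^ 16)"
    and Gauss_odd_part:
      "(psi q - psi (- q)) / 2 = q * qpochs_inf [- (q ^ 2), - (q ^ 14), q ^ 16] (q ^ 16)"
proof -
  have q16: "norm (q ^ 16) < 1" using q by (simp add: norm_power power_less_one_iff)
  have ivl: "{n * 4..<n * 4 + 4} = {4 * n, 4 * n + 1, 4 * n + 2, 4 * n + 3}" for n :: nat by auto
  have ev: "even (triangle (4 * n))" "odd (triangle (4 * n + 1))"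
    "odd (triangle (4 * n + 2))" "even (triangle (4 * n + 3))" for n
    using triangle_4[of n] triangle_4_1[of n] triangle_4_2[of n] triangle_4_3[of n] by presburger+
  then have ev': "odd (triangle (Suc (4 * n)))" "odd (triangle (Suc (Suc (4 * n))))" for n
    by (metis Suc_eq_plus1, metis add_2_eq_Suc')
  have f: "(\<lambda>n. q ^ triangle n) sums psi q"
    unfolding psi_def by (rule Gauss_triangle_sums'[OF q(1)])
  have g: "(\<lambda>n. (- q) ^ triangle n) sums psi (- q)"
    unfolding psi_def using q by (intro Gauss_triangle_sums') simp
  have pow: "(- q) ^ m = (if even m then q ^ m else - (q ^ m))" for m by simp
  have S: "(\<lambda>n. q ^ triangle (4 * n) + q ^ triangle (4 * n + 3)) sums ((psi q + psi (- q)) / 2)"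
    using sums_divide[OF sums_group[OF sums_add[OF f g], of 4], of 2]
    unfolding ivl pow by (simp add: ev ev' add_divide_distrib del: triangle_Suc)
  \<comment> \<open>With z = q^6, residue 0 supplies z^(-n) and residue 3 supplies z^(n+1).\<close>
  have "q ^ triangle (4 * n) + q ^ triangle (4 * n + 3)
      = (q ^ 16) ^ triangle n * ((q ^ 6) ^ (n + 1) + (1 / q ^ 6) ^ n)" for n
  proof -
    have "q ^ triangle (4 * n) * (q ^ 6) ^ n = (q ^ 16) ^ triangle n"
      unfolding power_mult[symmetric] power_add[symmetric] triangle_4 by simp
    then have "q ^ triangle (4 * n) = (q ^ 16) ^ triangle n * (1 / q ^ 6) ^ n"
      using q(2) unfolding power_one_over
      by (metis nonzero_eq_divide_eq power_not_zero times_divide_eq_right mult.right_neutral)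
    moreover have "q ^ triangle (4 * n + 3) = (q ^ 16) ^ triangle n * (q ^ 6) ^ (n + 1)"
      unfolding triangle_4_3 power_mult[symmetric] power_add[symmetric] by (simp add: algebra_simps)
    ultimately show ?thesis by (simp only: distrib_left add.commute)
  qed
  moreover have "q ^ 16 / q ^ 6 = q ^ 10"
    using power_diff[OF q(2), of 6 16] by simp
  moreover have "(qpoch_inf (q ^ 16) (q ^ 16) * qpoch_inf (- (q ^ 6)) (q ^ 16) *
      qpoch_inf (- (q ^ 10)) (q ^ 16)) = qpochs_inf [- (q ^ 6), - (q ^ 10), q ^ 16] (q ^ 16)"
    unfolding qpochs_inf_def by (simp only: list.map prod_list.Cons prod_list.Nil mult_1_left mult_1_right mult_ac)
  ultimately have "(\<lambda>n. q ^ triangle (4 * n) + q ^ triangle (4 * n + 3))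
      sums (qpochs_inf [- (q ^ 6), - (q ^ 10), q ^ 16] (q ^ 16))"
    using Jacobi_triple_product[OF q16, of "q ^ 6"] q(2)
    by (simp only: power_eq_0_iff simp_thms if_True if_False)
  with S show "(psi q + psi (- q)) / 2 = qpochs_inf [- (q ^ 6), - (q ^ 10), q ^ 16] (q ^ 16)"
    by (rule sums_unique2)
  have S: "(\<lambda>n. q ^ triangle (4 * n + 1) + q ^ triangle (4 * n + 2)) sums ((psi q - psi (- q)) / 2)"
    using sums_divide[OF sums_group[OF sums_diff[OF f g], of 4], of 2]
    unfolding ivl pow by (simp add: ev ev' add_divide_distrib del: triangle_Suc)
  \<comment> \<open>With z = q^2 and a factor q taken out, residue 1 supplies z^(-n) and residue 2
    supplies z^(n+1).\<close>
  have "q ^ triangle (4 * n + 1) + q ^ triangle (4 * n + 2)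
      = q * ((q ^ 16) ^ triangle n * ((q ^ 2) ^ (n + 1) + (1 / q ^ 2) ^ n))" for n
  proof -
    have "q ^ triangle (4 * n + 1) * (q ^ 2) ^ n = q ^ (16 * triangle n + 1)"
      unfolding power_mult[symmetric] power_add[symmetric] triangle_4_1 ..
    also have "\<dots> = q * (q ^ 16) ^ triangle n"
      by (simp add: power_mult)
    finally have "q ^ triangle (4 * n + 1) = q * (q ^ 16) ^ triangle n * (1 / q ^ 2) ^ n"
      using q(2) unfolding power_one_over
      by (metis nonzero_eq_divide_eq power_not_zero times_divide_eq_right mult.right_neutral)
    then have "q ^ triangle (4 * n + 1) = q * ((q ^ 16) ^ triangle n * (1 / q ^ 2) ^ n)"
      by (simp only: mult.assoc)
    moreover have "q ^ triangle (4 * n + 2) = q * ((q ^ 16) ^ triangle n * (q ^ 2) ^ (n + 1))"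
      unfolding triangle_4_2 power_mult[symmetric] by (simp add: power_add power2_eq_square power3_eq_cube algebra_simps)
    ultimately show ?thesis by (simp only: distrib_left add.commute)
  qed
  moreover have "q ^ 16 / q ^ 2 = q ^ 14"
    using power_diff[OF q(2), of 2 16] by simp
  moreover have "q * (qpoch_inf (q ^ 16) (q ^ 16) * qpoch_inf (- (q ^ 2)) (q ^ 16) *
      qpoch_inf (- (q ^ 14)) (q ^ 16)) = q * qpochs_inf [- (q ^ 2), - (q ^ 14), q ^ 16] (q ^ 16)"
    unfolding qpochs_inf_def by (simp only: list.map prod_list.Cons prod_list.Nil mult_1_left mult_1_right mult_ac)
  ultimately have "(\<lambda>n. q ^ triangle (4 * n + 1) + q ^ triangle (4 * n + 2))
      sums (q * qpochs_inf [- (q ^ 2), - (q ^ 14), q ^ 16] (q ^ 16))"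
    using sums_mult[OF Jacobi_triple_product[OF q16, of "q ^ 2"], of q] q(2)
    by (simp only: power_eq_0_iff simp_thms if_True if_False)
  with S show "(psi q - psi (- q)) / 2 = q * qpochs_inf [- (q ^ 2), - (q ^ 14), q ^ 16] (q ^ 16)"
    by (rule sums_unique2)
qed

subsection \<open>Double series\<close>

text \<open>The product majorant gives absolute summability over all pairs, so the unordered double
  sum equals the iterated sum, which is known to be \<open>s\<close>.\<close>

lemma has_sum_dominated_product:
  fixes f :: "nat \<times> nat \<Rightarrow> complex" and a b :: "nat \<Rightarrow> real"
  assumes dom: "\<And>i j. norm (f (i, j)) \<le> a i * b j"
    and nonneg: "\<And>i. a i \<ge> 0" "\<And>j. b j \<ge> 0"
    and ab: "summable a" "summable b"
    and rows: "\<And>i. (\<lambda>j. f (i, j)) sums g i" and g: "g sums s"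
  shows "(f has_sum s) UNIV"
proof -
  have "((\<lambda>j. a i * b j) has_sum a i * suminf b) UNIV" for i
    using nonneg ab by (intro norm_summable_imp_has_sum sums_mult) (auto intro: summable_mult)
  moreover have "(\<lambda>i. a i * suminf b) summable_on UNIV"
    using nonneg ab by (intro norm_summable_imp_summable_on)
      (auto simp: abs_mult suminf_nonneg intro: summable_mult2)
  ultimately have "(\<lambda>(i, j). a i * b j) summable_on UNIV \<times> UNIV"
    using nonneg by (intro summable_on_SigmaI[where g = "\<lambda>i. a i * suminf b"]) auto
  then have "(\<lambda>x. norm (f x)) summable_on UNIV \<times> UNIV"
    by (rule Infinite_Sum.abs_summable_on_comparison_test') (use dom in auto)
  then have "f summable_on UNIV \<times> UNIV"
    by (rule abs_summable_summable)
  then have total: "(f has_sum infsum f (UNIV \<times> UNIV)) (UNIV \<times> UNIV)"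
    by (rule has_sum_infsum)
  have "((\<lambda>j. f (i, j)) has_sum g i) UNIV" for i
  proof (rule norm_summable_imp_has_sum[OF _ rows])
    show "summable (\<lambda>j. norm (f (i, j)))"
      by (rule summable_comparison_test'[OF summable_mult[OF ab(2), of "a i"]]) (use dom in auto)
  qed
  then have "(g has_sum infsum f (UNIV \<times> UNIV)) UNIV"
    using has_sum_SigmaD[OF total] by simp
  with g have "infsum f (UNIV \<times> UNIV) = s"
    using has_sum_imp_sums sums_unique2 by blast
  with total show ?thesis by simp
qed

text \<open>Comparison with a geometric series. The slack of 1 admits exponents such as
  \<open>triangle (i - 1)\<close>, which is still 0 at i = 1.\<close>

lemma summable_norm_power_superlinear:
  fixes q :: complex
  assumes q: "norm q < 1" and h: "\<And>i. i \<le> Suc (h i)"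
  shows "summable (\<lambda>i. norm (q ^ h i))"
proof (rule summable_comparison_test')
  show "summable (\<lambda>i. norm q ^ (i - 1))"
    using q by (subst summable_Suc_iff[symmetric]) (simp add: summable_geometric)
  show "norm (norm (q ^ h i)) \<le> norm q ^ (i - 1)" for i
    using q h[of i] by (auto simp: norm_power intro!: power_decreasing)
qed

text \<open>The sum over \<open>j\<close> is Euler's series at z = q^(k+1), with value (q;q)_k /
  (q;q)_inf. Against the denominator (q;q)_n this leaves the factor 1 if k = n, and 1 - q^(n+1) if k
  = n + 1, which is what makes a series telescope.\<close>

lemma has_sum_Euler_inverse_rows:
  fixes q :: complex and A :: "nat \<Rightarrow> complex" and k n :: "nat \<Rightarrow> nat"
  assumes q: "norm q < 1" and A: "summable (\<lambda>i. norm (A i))"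
    and S: "(\<lambda>i. A i * qpoch q q (k i) / qpoch q q (n i)) sums s"
  shows "((\<lambda>(i, j). A i * (q ^ (k i + 1)) ^ j / (qpoch q q (n i) * qpoch q q j))
    has_sum s / qpoch_inf q q) UNIV"
proof -
  obtain C where C: "C > 0" "\<And>n. norm (1 / qpoch q q n) \<le> C"
    using inverse_qpoch_bounded[OF q] by blast
  note nz = qpoch_nonzero[OF q q] qpoch_inf_nonzero[OF q q]
  define f where "f = (\<lambda>(i, j). A i * (q ^ (k i + 1)) ^ j / (qpoch q q (n i) * qpoch q q j))"
  have "(f has_sum s / qpoch_inf q q) UNIV"
  proof (rule has_sum_dominated_product)
    fix i j
    \<comment> \<open>The exponent is at least j, which makes the bound in j independent of
      i.\<close>
    have "norm q ^ ((k i + 1) * j) \<le> norm q ^ j"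
      using q by (intro power_decreasing) auto
    then have "norm (A i) * norm ((q ^ (k i + 1)) ^ j) *
        (norm (1 / qpoch q q (n i)) * norm (1 / qpoch q q j)) \<le> norm (A i) * norm q ^ j * (C * C)"
      using C unfolding power_mult[symmetric] norm_power by (intro mult_mono) auto
    then show "norm (f (i, j)) \<le> (C * C * norm (A i)) * norm q ^ j"
      by (simp add: f_def norm_mult norm_divide norm_power mult_ac)
  next
    fix i
    have "qpoch_inf q q = qpoch q q (k i) * qpoch_inf (q ^ (k i + 1)) q"
      using qpoch_inf_split[OF q, of q "k i"] by simp
    then have eq: "1 / qpoch_inf (q ^ (k i + 1)) q = qpoch q q (k i) / qpoch_inf q q"
      using nz by (auto simp: field_simps)
    have "norm (q ^ (k i + 1)) < 1"
      using q by (simp add: norm_power power_less_one_iff del: power_Suc)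
    from sums_mult[OF Euler_inverse_product[OF q this], of "A i / qpoch q q (n i)"]
    show "(\<lambda>j. f (i, j)) sums (A i * qpoch q q (k i) / qpoch q q (n i) / qpoch_inf q q)"
      unfolding eq by (simp add: f_def)
  next
    show "(\<lambda>i. A i * qpoch q q (k i) / qpoch q q (n i) / qpoch_inf q q) sums (s / qpoch_inf q q)"
      by (rule sums_divide[OF S])
    show "summable (\<lambda>i. C * C * norm (A i))" using summable_mult[OF A, of "C * C"] .
    show "summable (\<lambda>j. norm q ^ j)" using q by (simp add: summable_geometric)
  qed (use C in auto)
  then show ?thesis by (simp add: f_def)
qed

text \<open>The sum over \<open>i\<close> is Euler's series at z = q^k, with value (-q;q)_inf /
  (-q;q)_k. The denominators (q;q)_k and (-q;q)_k combine to (q^2;q^2)_k.\<close>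

lemma has_sum_Euler_product_columns:
  fixes q :: complex and A :: "nat \<Rightarrow> complex" and k :: "nat \<Rightarrow> nat"
  assumes q: "norm q < 1" and A: "summable (\<lambda>j. norm (A j))"
    and S: "(\<lambda>j. A j / qpoch (q\<^sup>2) (q\<^sup>2) (k j)) sums s"
  shows "((\<lambda>(i, j). q ^ triangle i * (q ^ k j) ^ i * A j / (qpoch q q i * qpoch q q (k j)))
    has_sum s * qpoch_inf (- q) q) UNIV"
proof -
  obtain C where C: "C > 0" "\<And>n. norm (1 / qpoch q q n) \<le> C"
    using inverse_qpoch_bounded[OF q] by blast
  have q': "norm (- q) < 1" using q by simp
  note nz = qpoch_nonzero[OF q q] qpoch_nonzero[OF q q']
  \<comment> \<open>The coordinates are swapped so that the inner sum runs over i; they are swapped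
    back at the end.\<close>
  define f where "f = (\<lambda>(j, i). q ^ triangle i * (q ^ k j) ^ i * A j / (qpoch q q i * qpoch q q (k j)))"
  have "(f has_sum s * qpoch_inf (- q) q) UNIV"
  proof (rule has_sum_dominated_product)
    fix j i
    have "norm q ^ (k j * i) \<le> 1"
      using q by (intro power_le_one) auto
    then have "norm q ^ triangle i * norm ((q ^ k j) ^ i) * norm (A j) * (norm (1 / qpoch q q i) * norm (1 / qpoch q q (k j)))
        \<le> norm q ^ triangle i * 1 * norm (A j) * (C * C)"
      using C unfolding power_mult[symmetric] norm_power by (intro mult_mono) auto
    then show "norm (f (j, i)) \<le> (C * C * norm (A j)) * (norm q ^ triangle i * 1 ^ i)"
      by (simp add: f_def norm_mult norm_divide norm_power mult_ac)
  next
    fix j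
    have "qpoch_inf (- q) q = qpoch (- q) q (k j) * qpoch_inf (- (q ^ k j) * q) q"
      using qpoch_inf_split[OF q, of "- q" "k j"] by (simp add: mult_ac)
    then have eq: "qpoch_inf (- (q ^ k j) * q) q = qpoch_inf (- q) q / qpoch (- q) q (k j)"
      using nz by (simp add: field_simps)
    from sums_mult[OF Euler_product[OF q, of "q ^ k j"], of "A j / qpoch q q (k j)"]
    show "(\<lambda>i. f (j, i)) sums (A j / qpoch (q\<^sup>2) (q\<^sup>2) (k j) * qpoch_inf (- q) q)"
      unfolding eq qpoch_square by (simp add: f_def mult_ac)
  next
    show "(\<lambda>j. A j / qpoch (q\<^sup>2) (q\<^sup>2) (k j) * qpoch_inf (- q) q) sums (s * qpoch_inf (- q) q)"
      by (rule sums_mult2[OF S])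
    show "summable (\<lambda>j. C * C * norm (A j))" using summable_mult[OF A, of "C * C"] .
    show "summable (\<lambda>i. norm q ^ triangle i * 1 ^ i)" using q by (intro summable_triangle) auto
  qed (use C in auto)
  then have "((\<lambda>(x, y). f (y, x)) has_sum s * qpoch_inf (- q) q) (UNIV \<times> UNIV)"
    by (subst has_sum_swap[symmetric]) simp
  then show ?thesis by (simp add: f_def)
qed

section \<open>Real powers of q and triangular exponents\<close>

lemma qpow_add: "qpow \<tau> (x + y) = qpow \<tau> x * qpow \<tau> y"
  by (simp add: qpow_def exp_add[symmetric] algebra_simps)

lemma qpow_power: "qpow \<tau> x ^ n = qpow \<tau> (real n * x)"
  by (simp add: qpow_def exp_of_nat_mult[symmetric] mult_ac)

lemma norm_qpow_less_1:
  assumes "Im \<tau> > 0" "x > 0"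
  shows "norm (qpow \<tau> x) < 1"
  using assms by (simp add: qpow_def)

lemma qpow_nonzero: "qpow \<tau> x \<noteq> 0"
  by (simp add: qpow_def)

lemma real_triangle: "real (triangle n) = (real n ^ 2 + real n) / 2"
  by (induction n) (simp_all add: power2_eq_square field_simps)

lemma real_triangle_pred: "real (triangle (n - 1)) = (real n ^ 2 - real n) / 2"
  by (cases n) (simp_all add: real_triangle power2_eq_square field_simps)

lemma le_triangle: "n \<le> triangle n"
  by (induction n) simp_all

lemma telescope_sums_power:
  fixes q :: complex
  assumes q: "norm q < 1" and h: "\<And>n. n \<le> Suc (h n)"
  shows "(\<lambda>n. q ^ h n - q ^ h (Suc n)) sums (q ^ h 0)"
proof -
  have "(\<lambda>n. q ^ h n) \<longlonglongrightarrow> 0"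
    by (rule summable_LIMSEQ_zero[OF summable_norm_cancel[OF summable_norm_power_superlinear[OF q h]]])
  from telescope_sums'[OF this] show ?thesis by simp
qed

section \<open>Evaluation of the seven double series\<close>

theorem theorem3p1:
  fixes \<tau> q :: complex and \<alpha> :: real
  assumes "Im \<tau> > 0" and "q = qpow \<tau> 1" and "\<alpha> > 0"
  shows
    "((\<lambda>(i::nat, j::nat). qpow \<tau> (\<alpha> * real i ^ 2 + 2 * real i * real j + \<alpha> * real i + real j)
          / (qpoch q q (2 * i) * qpoch q q j))
        has_sum (qpoch_inf (- qpow \<tau> (2 * \<alpha>)) (qpow \<tau> (2 * \<alpha>)) ^ 2
                   * qpoch_inf (qpow \<tau> (2 * \<alpha>)) (qpow \<tau> (2 * \<alpha>)) / qpoch_inf q q)) UNIV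
     \<and>
     ((\<lambda>(i::nat, j::nat). qpow \<tau> (\<alpha> * real i ^ 2 + 2 * real i * real j + \<alpha> * real i + 2 * real j)
          / (qpoch q q (2 * i + 1) * qpoch q q j))
        has_sum (qpoch_inf (- qpow \<tau> (2 * \<alpha>)) (qpow \<tau> (2 * \<alpha>)) ^ 2
                   * qpoch_inf (qpow \<tau> (2 * \<alpha>)) (qpow \<tau> (2 * \<alpha>)) / qpoch_inf q q)) UNIV
     \<and>
     ((\<lambda>(i::nat, j::nat). qpow \<tau> (1/2 * real i ^ 2 + 2 * real i * real j - 1/2 * real i + 2 * real j)
          / (qpoch q q (2 * i) * qpoch q q j))
        has_sum (2 / qpoch_inf q q)) UNIV
     \<and>
     ((\<lambda>(i::nat, j::nat). qpow \<tau> (real i ^ 2 + 2 * real i * real j + 2 * real j)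
          / (qpoch q q (2 * i) * qpoch q q j))
        has_sum (1 / qpoch_inf q q)) UNIV
     \<and>
     ((\<lambda>(i::nat, j::nat). qpow \<tau> (real i ^ 2 + 2 * real i * real j + real i + 3 * real j)
          / (qpoch q q (2 * i + 1) * qpoch q q j))
        has_sum (1 / qpoch_inf q q)) UNIV
     \<and>
     ((\<lambda>(i::nat, j::nat). qpow \<tau> (1/2 * real i ^ 2 + 2 * real i * real j + 1/2 * real i + 2 * real j)
          / (qpoch q q i * qpoch q q (2 * j)))
        has_sum (qpochs_inf [- (q ^ 6), - (q ^ 10), q ^ 16] (q ^ 16) / qpoch_inf q q)) UNIV
     \<and>
     ((\<lambda>(i::nat, j::nat). qpow \<tau> (1/2 * real i ^ 2 + 2 * real i * real j + 3/2 * real i + 2 * real j)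
          / (qpoch q q i * qpoch q q (2 * j + 1)))
        has_sum (qpochs_inf [- (q ^ 2), - (q ^ 14), q ^ 16] (q ^ 16) / qpoch_inf q q)) UNIV"
proof -
  note [simp del] = triangle_Suc power_Suc
  have q: "norm q < 1" and q0: "q \<noteq> 0"
    using norm_qpow_less_1[OF assms(1), of 1] qpow_nonzero[of \<tau> 1] by (simp_all add: assms(2))
  have qpow_q: "q ^ n = qpow \<tau> (real n)" for n by (simp add: assms(2) qpow_power)
  define Q where "Q = qpow \<tau> (2 * \<alpha>)"
  have Q: "norm Q < 1" unfolding Q_def using assms by (intro norm_qpow_less_1) auto
  note nz = qpoch_nonzero[OF q q] qpoch_inf_nonzero[OF q q]
  have ratio: "x * qpoch q q (Suc n) / qpoch q q n = x - x * q ^ Suc n" for x n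
  proof -
    have "qpoch q q (Suc n) / qpoch q q n = 1 - q ^ Suc n"
      using nz(1)[of n] by (simp add: qpoch_Suc power_Suc)
    then show ?thesis
      unfolding times_divide_eq_right[symmetric] by (simp add: right_diff_distrib)
  qed
  have summ: "summable (\<lambda>i. norm (x ^ triangle i))" if "norm x < 1" for x :: complex
    using that by (rule summable_norm_power_superlinear) (rule le_SucI[OF le_triangle])
  note to_qpow = qpow_q qpow_power Q_def qpow_add[symmetric]

  \<comment> \<open>Here and in the next case k = n, so Gauss' series in the base Q = q^(2 alpha) is
    all that remains.\<close>
  have 1: "((\<lambda>(i, j). Q ^ triangle i * (q ^ (2 * i + 1)) ^ j / (qpoch q q (2 * i) * qpoch q q j))
      has_sum (qpoch_inf (- Q) Q ^ 2 * qpoch_inf Q Q / qpoch_inf q q)) UNIV"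
    using Gauss_triangle_sums[OF Q] nz by (intro has_sum_Euler_inverse_rows q summ Q) simp
  have 2: "((\<lambda>(i, j). Q ^ triangle i * (q ^ (2 * i + 1 + 1)) ^ j / (qpoch q q (2 * i + 1) * qpoch q q j))
      has_sum (qpoch_inf (- Q) Q ^ 2 * qpoch_inf Q Q / qpoch_inf q q)) UNIV"
    using Gauss_triangle_sums[OF Q] nz by (intro has_sum_Euler_inverse_rows q summ Q) simp
  have 3: "((\<lambda>(i, j). q ^ triangle (i - 1) * (q ^ (2 * i + 1 + 1)) ^ j / (qpoch q q (2 * i) * qpoch q q j))
      has_sum (2 / qpoch_inf q q)) UNIV"
  proof (rule has_sum_Euler_inverse_rows[OF q])
    have h: "n \<le> Suc (triangle (n - 1))" for n using le_triangle[of "n - 1"] by simp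
    show "summable (\<lambda>i. norm (q ^ triangle (i - 1)))"
      using q h by (rule summable_norm_power_superlinear)
    \<comment> \<open>The remaining difference skips an index, so it splits into two telescoping
      series with sum 1 each; hence the 2. At n = 0 the truncated n - 1 is harmless, since n(n-1)/2
      is 0 there as well.\<close>
    have "(\<lambda>n. (q ^ triangle (n - 1) - q ^ triangle (Suc n - 1)) + (q ^ triangle n - q ^ triangle (Suc n)))
        sums (q ^ triangle (0 - 1) + q ^ triangle 0)"
      using q h le_triangle by (intro sums_add telescope_sums_power) (auto intro: le_SucI)
    moreover have "q ^ triangle (i - 1) * qpoch q q (2 * i + 1) / qpoch q q (2 * i)
        = (q ^ triangle (i - 1) - q ^ triangle (Suc i - 1)) + (q ^ triangle i - q ^ triangle (Suc i))" for i
    proof -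
      have "triangle (i - 1) + Suc (2 * i) = triangle (Suc i)"
        by (cases i) (simp_all add: triangle_Suc)
      then have "q ^ triangle (Suc i) = q ^ triangle (i - 1) * q ^ Suc (2 * i)"
        by (metis power_add)
      then show ?thesis using ratio[of _ "2 * i"] by simp
    qed
    ultimately show "(\<lambda>i. q ^ triangle (i - 1) * qpoch q q (2 * i + 1) / qpoch q q (2 * i)) sums 2"
      by simp
  qed
  have 4: "((\<lambda>(i, j). q ^ (i ^ 2) * (q ^ (2 * i + 1 + 1)) ^ j / (qpoch q q (2 * i) * qpoch q q j))
      has_sum (1 / qpoch_inf q q)) UNIV"
  proof (rule has_sum_Euler_inverse_rows[OF q])
    have h: "n \<le> Suc (n ^ 2)" for n :: nat by (cases n) (simp_all add: power2_eq_square)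
    show "summable (\<lambda>i. norm (q ^ (i ^ 2)))"
      using q h by (rule summable_norm_power_superlinear)
    \<comment> \<open>The leftover factor 1 - q^(2i+1) fits because consecutive squares differ by 2i
      + 1.\<close>
    have "q ^ (i ^ 2) * qpoch q q (2 * i + 1) / qpoch q q (2 * i) = q ^ (i ^ 2) - q ^ (Suc i ^ 2)" for i
    proof -
      have "q ^ (Suc i ^ 2) = q ^ (i ^ 2) * q ^ Suc (2 * i)"
        unfolding power_add[symmetric] by (rule arg_cong[where f = "\<lambda>n. q ^ n"]) (simp add: power2_eq_square)
      then show ?thesis using ratio[of _ "2 * i"] by simp
    qed
    then show "(\<lambda>i. q ^ (i ^ 2) * qpoch q q (2 * i + 1) / qpoch q q (2 * i)) sums 1"
      using telescope_sums_power[OF q h] by simp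
  qed
  have 5: "((\<lambda>(i, j). q ^ (i * (i + 1)) * (q ^ (2 * i + 2 + 1)) ^ j / (qpoch q q (2 * i + 1) * qpoch q q j))
      has_sum (1 / qpoch_inf q q)) UNIV"
  proof (rule has_sum_Euler_inverse_rows[OF q])
    have h: "n \<le> Suc (n * (n + 1))" for n :: nat by simp
    show "summable (\<lambda>i. norm (q ^ (i * (i + 1))))"
      using q h by (rule summable_norm_power_superlinear)
    \<comment> \<open>Likewise, consecutive values of i(i+1) differ by 2i + 2.\<close>
    have "q ^ (i * (i + 1)) * qpoch q q (2 * i + 2) / qpoch q q (2 * i + 1)
        = q ^ (i * (i + 1)) - q ^ (Suc i * (Suc i + 1))" for i
    proof -
      have "q ^ (Suc i * (Suc i + 1)) = q ^ (i * (i + 1)) * q ^ Suc (2 * i + 1)"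
        unfolding power_add[symmetric] by (rule arg_cong[where f = "\<lambda>n. q ^ n"]) simp
      then show ?thesis using ratio[of _ "2 * i + 1"] by simp
    qed
    then show "(\<lambda>i. q ^ (i * (i + 1)) * qpoch q q (2 * i + 2) / qpoch q q (2 * i + 1)) sums 1"
      using telescope_sums_power[OF q h] by simp
  qed
  define E where "E x = 1 / qpoch_inf x (q\<^sup>2)" for x
  have summ2: "summable (\<lambda>j. norm (q ^ (2 * j)))"
    using q by (rule summable_norm_power_superlinear) simp
  have W: "qpoch_inf (q\<^sup>2) (q\<^sup>2) = qpoch_inf q q * qpoch_inf (- q) q"
    by (rule qpoch_inf_square[OF q])
  have 6: "((\<lambda>(i, j). q ^ triangle i * (q ^ (2 * j)) ^ i * q ^ (2 * j) / (qpoch q q i * qpoch q q (2 * j)))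
      has_sum (qpochs_inf [- (q ^ 6), - (q ^ 10), q ^ 16] (q ^ 16) / qpoch_inf q q)) UNIV"
  proof -
    \<comment> \<open>Gauss' products at q and -q share the numerator (q^2;q^2)_inf, which
      \<open>W\<close> factors. Dividing by (q;q)_inf leaves the factor (-q;q)_inf that the column
      summation produces.\<close>
    have "qpochs_inf [- (q ^ 6), - (q ^ 10), q ^ 16] (q ^ 16)
        = (qpoch_inf q q * qpoch_inf (- q) q) * ((E q + E (- q)) / 2)"
      using Gauss_even_part[OF q q0] by (simp add: E_def W algebra_simps add_divide_distrib)
    then have *: "qpochs_inf [- (q ^ 6), - (q ^ 10), q ^ 16] (q ^ 16) / qpoch_inf q q
        = (E q + E (- q)) / 2 * qpoch_inf (- q) q"
      using nz by simp
    from has_sum_Euler_product_columns[OF q summ2 Euler_even_part[OF q, folded E_def]]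
    show ?thesis unfolding * .
  qed
  have 7: "((\<lambda>(i, j). q ^ triangle i * (q ^ (2 * j + 1)) ^ i * q ^ (2 * j) / (qpoch q q i * qpoch q q (2 * j + 1)))
      has_sum (qpochs_inf [- (q ^ 2), - (q ^ 14), q ^ 16] (q ^ 16) / qpoch_inf q q)) UNIV"
  proof -
    have "q * qpochs_inf [- (q ^ 2), - (q ^ 14), q ^ 16] (q ^ 16)
        = (qpoch_inf q q * qpoch_inf (- q) q) * ((E q - E (- q)) / 2)"
      using Gauss_odd_part[OF q q0] by (simp add: E_def W algebra_simps diff_divide_distrib)
    then have "qpochs_inf [- (q ^ 2), - (q ^ 14), q ^ 16] (q ^ 16)
        = (qpoch_inf q q * qpoch_inf (- q) q) * ((E q - E (- q)) / 2) / q"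
      using q0 by (metis nonzero_mult_div_cancel_left)
    then have *: "qpochs_inf [- (q ^ 2), - (q ^ 14), q ^ 16] (q ^ 16) / qpoch_inf q q
        = (E q - E (- q)) / 2 / q * qpoch_inf (- q) q"
      using nz by simp
    \<comment> \<open>The odd part has q^(2j+1) where the double series has q^(2j); the division by
      q also absorbs the extra q of Gauss' odd part.\<close>
    have "q ^ (2 * j + 1) / c / q = q ^ (2 * j) / c" for j c
      using q0 by (simp add: power_Suc)
    with sums_divide[OF Euler_odd_part[OF q, folded E_def], of q]
    have "(\<lambda>j. q ^ (2 * j) / qpoch (q\<^sup>2) (q\<^sup>2) (2 * j + 1)) sums ((E q - E (- q)) / 2 / q)"
      by (simp only:)
    from has_sum_Euler_product_columns[OF q summ2 this]
    show ?thesis unfolding * .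
  qed
  \<comment> \<open>In each of the seven matchings the right side is collected into a single
    \<open>qpow\<close>, and the real exponents are compared as polynomials in i and j.\<close>
  have e1: "qpow \<tau> (\<alpha> * real i ^ 2 + 2 * real i * real j + \<alpha> * real i + real j)
      = Q ^ triangle i * (q ^ (2 * i + 1)) ^ j" for i j
    unfolding to_qpow real_triangle by (rule arg_cong[where f = "qpow \<tau>"]) (simp add: field_simps)
  have e2: "qpow \<tau> (\<alpha> * real i ^ 2 + 2 * real i * real j + \<alpha> * real i + 2 * real j)
      = Q ^ triangle i * (q ^ (2 * i + 1 + 1)) ^ j" for i j
    unfolding to_qpow real_triangle by (rule arg_cong[where f = "qpow \<tau>"]) (simp add: field_simps)
  have e3: "qpow \<tau> (1/2 * real i ^ 2 + 2 * real i * real j - 1/2 * real i + 2 * real j)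
      = q ^ triangle (i - 1) * (q ^ (2 * i + 1 + 1)) ^ j" for i j
    unfolding to_qpow real_triangle_pred by (rule arg_cong[where f = "qpow \<tau>"]) (simp add: field_simps)
  have e4: "qpow \<tau> (real i ^ 2 + 2 * real i * real j + 2 * real j)
      = q ^ (i ^ 2) * (q ^ (2 * i + 1 + 1)) ^ j" for i j
    unfolding to_qpow by (rule arg_cong[where f = "qpow \<tau>"]) (simp add: field_simps)
  have e5: "qpow \<tau> (real i ^ 2 + 2 * real i * real j + real i + 3 * real j)
      = q ^ (i * (i + 1)) * (q ^ (2 * i + 2 + 1)) ^ j" for i j
    unfolding to_qpow by (rule arg_cong[where f = "qpow \<tau>"]) (simp add: field_simps power2_eq_square)
  have e6: "qpow \<tau> (1/2 * real i ^ 2 + 2 * real i * real j + 1/2 * real i + 2 * real j)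
      = q ^ triangle i * (q ^ (2 * j)) ^ i * q ^ (2 * j)" for i j
    unfolding to_qpow real_triangle by (rule arg_cong[where f = "qpow \<tau>"]) (simp add: field_simps)
  have e7: "qpow \<tau> (1/2 * real i ^ 2 + 2 * real i * real j + 3/2 * real i + 2 * real j)
      = q ^ triangle i * (q ^ (2 * j + 1)) ^ i * q ^ (2 * j)" for i j
    unfolding to_qpow real_triangle by (rule arg_cong[where f = "qpow \<tau>"]) (simp add: field_simps)
  show ?thesis
    unfolding e1 e2 e3 e4 e5 e6 e7 Q_def[symmetric]
    by (intro conjI 1 2 3 4 5 6 7)
qed

end
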